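(* Let $V$ be a vector space over $\mathbb{R}$ endowed with a norm $\|\cdot\|$, with dual space $V^*$, and suppose that $\mu$ is a Borel measure on $V^*$ such that $$\|x\|=\int_{V^*}|x\ell|\,\mu(\mathrm{d}\ell)\quad\text{for all }x\in V.$$ Let $X$ be any random vector in $V$. Then for any natural $j$ $$\mathsf{E}\|X\|^j=\Big(\frac2\pi\Big)^j\int_{(V^*\times(0,\infty))^j}\bigg(\mathsf{E}\prod_{\alpha=1}^j\big(1-\Re\, e^{it_\alpha X\ell_\alpha}\big)\bigg)\prod_{\alpha=1}^j\frac{\mu(\mathrm{d}\ell_\alpha)\,\mathrm{d}t_\alpha}{t_\alpha^2},$$ and the expectation in the integrand equals $$\sum_{(A,B)}\Big(-\frac12\Big)^{|A\cup B|}\,\mathsf{E}\exp\Big\{iX\Big(\sum_{\alpha\in A}t_\alpha\ell_\alpha-\sum_{\beta\in B}t_\beta\ell_\beta\Big)\Big\},$$ where $\sum_{(A,B)}$ denotes summation over all ordered pairs $(A,B)$ of disjoint subsets of the set $\{1,\dots,j\}$ and $|A\cup B|$ denotes the cardinality of $A\cup B$.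
   Context: For $x\in V$ and $\ell\in V^*$, $x\ell$ denotes the value of the linear functional $\ell$ at $x$. $\mathsf{E}$ denotes expectation and $\Re$ the real part. *)

theory Defs
  imports "HOL-Probability.Probability"
begin

text \<open>
  A random vector in a normed space is a Borel map with almost surely separable range
  (that is, a strongly measurable map). The separability clause is automatic when the space is
  separable, see \<open>random_vector_iff_borel\<close>. For nonseparable spaces Borel measurability alone
  is too weak: if \<open>\<kappa>\<close> is an atomlessly measurable cardinal, \<open>K\<close> is a diffuse random element of
  \<open>\<kappa>\<close> and \<open>V\<close> is the \<open>l1\<close> space over \<open>\<kappa>\<close>, whose norm is represented by the counting measure on
  the coordinate functionals, then \<open>\<alpha> \<mapsto> (X \<omega>) \<alpha> = (if \<alpha> = K \<omega> then 1 else 0)\<close> has norm 1, but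
  every coordinate vanishes almost surely.
\<close>
definition random_vector :: "'w measure \<Rightarrow> ('w \<Rightarrow> 'a::real_normed_vector) \<Rightarrow> bool"
  where "random_vector M X \<longleftrightarrow>
    prob_space M \<and> X \<in> borel_measurable M \<and>
    (\<exists>D. countable D \<and> (AE \<omega> in M. X \<omega> \<in> closure D))"

lemma random_vector_iff_borel:
  fixes X :: "'w \<Rightarrow> 'a::{real_normed_vector, second_countable_topology}"
  shows "random_vector M X \<longleftrightarrow> prob_space M \<and> X \<in> borel_measurable M"
proof -
  obtain D :: "'a set" where D: "countable D" "\<And>U. open U \<Longrightarrow> U \<noteq> {} \<Longrightarrow> \<exists>d\<in>D. d \<in> U"
    using countable_dense_setE by blast
  have "x \<in> closure D" for x
    unfolding closure_iff_nhds_not_empty using D(2) by blast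
  then have "AE \<omega> in M. X \<omega> \<in> closure D" by simp
  with D(1) show ?thesis unfolding random_vector_def by blast
qed

definition one_minus_cf_expectation ::
    "'w measure \<Rightarrow> ('w \<Rightarrow> 'a::real_normed_vector) \<Rightarrow> nat \<Rightarrow> (nat \<Rightarrow> 'a \<Rightarrow>\<^sub>L real) \<Rightarrow> (nat \<Rightarrow> real) \<Rightarrow> real"
  where "one_minus_cf_expectation M X j l t =
    (\<integral>\<omega>. (\<Prod>\<alpha>\<in>{1..j}.
        1 - Re (exp (\<i> * complex_of_real (t \<alpha> * blinfun_apply (l \<alpha>) (X \<omega>))))) \<partial>M)"

definition disjoint_pairs :: "nat \<Rightarrow> (nat set \<times> nat set) set"
  where "disjoint_pairs j = {(A, B). A \<subseteq> {1..j} \<and> B \<subseteq> {1..j} \<and> A \<inter> B = {}}"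

end

theory Submission
  imports Defs "HOL-Real_Asymp.Real_Asymp"
begin

text \<open>
  For a real number \<open>a\<close> one has \<open>\<integral> (1 - cos (t a)) / t^2 dt = (\<pi>/2) \<bar>a\<bar>\<close> over \<open>t > 0\<close>
  (\<open>nn_integral_one_minus_cos\<close>). Taking \<open>a\<close> to be the value of a functional \<open>l\<close> at \<open>x\<close> and
  integrating over \<open>l\<close> turns the representation of the norm into
  \<open>norm x = (2/\<pi>) \<integral>\<integral> (1 - cos (t (l x))) / t^2 dt \<mu>(dl)\<close>. The \<open>j\<close>-th power of this
  integral is an integral of a product over \<open>j\<close> copies of the measure \<open>N = \<mu> \<Otimes> dt\<close>; put
  \<open>x = X \<omega>\<close>, take expectations and exchange the two integrals by Tonelli's theorem, all
  integrands being nonnegative. The second formula is pure algebra: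
  \<open>1 - cos u = 1 - e^(iu)/2 - e^(-iu)/2\<close>, and a product of such trinomials is expanded by
  deciding for each factor which of the three terms is chosen
  (\<open>one_minus_cf_expectation_expand\<close>).

  The exchange of integrals needs care, because nothing makes \<open>\<mu>\<close> \<open>\<sigma>\<close>-finite: it may have an
  infinite atom at the functional 0, and for a nonseparable space it may be as large as an
  uncountable sum of point masses. Three observations repair this.

  \<^item> The product measure on \<open>j\<close> copies still gives boxes their expected volume. This holds for
    arbitrary measures: the volume is countably additive on the semiring of boxes and is
    extended by Caratheodory's theorem (\<open>emeasure_PiM_box\<close>).
  \<^item> Up to a null set, \<open>X\<close> takes its values in the closure of a countable set \<open>D\<close>. Hence the
    integrand vanishes unless each pair \<open>(l, t)\<close> lies in the set \<open>S\<close> where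
    \<open>1 - cos (t (l d)) \<noteq> 0\<close> for some \<open>d \<in> D\<close>. On \<open>S\<close> the measure \<open>N\<close> is \<open>\<sigma>\<close>-finite, since each
    of these countably many functions, divided by \<open>t^2\<close>, has the finite integral
    \<open>(\<pi>/2) norm d\<close> (\<open>sigma_finite_density_support\<close>). Boxes determine the product measure on
    the power of \<open>S\<close>, so Tonelli's theorem applies there (\<open>nn_integral_prod_PiM_swap\<close>).
  \<^item> Evaluation \<open>(l, \<omega>) \<mapsto> l (X \<omega>)\<close> is measurable for the product of the two
    \<open>\<sigma>\<close>-algebras, again because \<open>X\<close> may be approximated by functions with values in \<open>D\<close>
    (\<open>measurable_blinfun_apply_separable\<close>).
\<close>

section \<open>The integral of \<open>(1 - cos (t a)) / t^2\<close>\<close>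

text \<open>
  Integration by parts reduces the integral to the sine integral: for \<open>b = \<bar>a\<bar>\<close> the function
  \<open>b Si (b t) - (1 - cos (b t)) / t\<close> is an antiderivative, which tends to 0 at 0 and to
  \<open>b \<pi> / 2\<close> at infinity.
\<close>
lemma nn_integral_one_minus_cos:
  fixes a :: real
  shows "(\<integral>\<^sup>+t. ennreal ((1 - cos (t * a)) / t\<^sup>2) \<partial>restrict_space lborel {0<..}) = ennreal (pi / 2 * \<bar>a\<bar>)"
proof (cases "a = 0")
  case False
  define b where "b = \<bar>a\<bar>"
  have b: "b > 0" using False by (simp add: b_def)
  have cos_b: "cos (t * a) = cos (b * t)" for t
    unfolding b_def by (cases "a \<ge> 0") (auto simp: mult.commute)
  define f where "f t = (1 - cos (b * t)) / t\<^sup>2" for t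
  define F where "F t = b * Si (b * t) - (1 - cos (b * t)) / t" for t
  have nonneg: "0 \<le> f t" for t by (simp add: f_def)
  have DF: "(F has_real_derivative f x) (at x)" if "x > 0" for x
    unfolding F_def[abs_def] f_def using that b
    by (auto intro!: derivative_eq_intros DERIV_chain2[OF DERIV_Si]
             simp: field_simps power2_eq_square)
  have Cf: "isCont f x" if "x > 0" for x
    unfolding f_def[abs_def] using that by (intro continuous_intros) auto
  have "((\<lambda>t. b * Si (b * t)) \<longlongrightarrow> b * Si (b * 0)) (at_right 0)"
    by (intro tendsto_intros isCont_tendsto_compose[OF isCont_Si])
  moreover have "((\<lambda>t. (1 - cos (b * t)) / t) \<longlongrightarrow> 0) (at_right 0)"
    by real_asymp
  ultimately have lim0: "(F \<longlongrightarrow> 0) (at_right 0)"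
    unfolding F_def[abs_def] using Si_neg[of 0] tendsto_diff by fastforce
  have "((\<lambda>t. Si (b * t)) \<longlongrightarrow> pi / 2) at_top"
    by (rule filterlim_compose[OF Si_at_top]) (use b in real_asymp)
  moreover have "((\<lambda>t. (1 - cos (b * t)) / t) \<longlongrightarrow> 0) at_top"
    using b by real_asymp
  ultimately have lim_top: "(F \<longlongrightarrow> b * (pi / 2)) at_top"
    unfolding F_def[abs_def] using tendsto_diff[OF tendsto_mult_left] by fastforce
  note FTC = interval_integral_FTC_nonneg[of 0 \<infinity> F f 0 "b * (pi / 2)"]
  have int: "set_integrable lborel (einterval 0 \<infinity>) f" and
    eq: "(LBINT x=0..\<infinity>. f x) = b * (pi / 2) - 0"
    by (rule FTC; use DF Cf nonneg lim0 lim_top in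
        \<open>auto simp: zero_ereal_def ereal_tendsto_simps\<close>)+
  have ei: "einterval 0 \<infinity> = {0<..}" by (auto simp: einterval_def)
  have "(\<integral>\<^sup>+t. ennreal ((1 - cos (t * a)) / t\<^sup>2) \<partial>restrict_space lborel {0<..}) =
     (\<integral>\<^sup>+t. ennreal (indicator {0<..} t *\<^sub>R f t) \<partial>lborel)"
    by (subst nn_integral_restrict_space)
       (auto intro!: nn_integral_cong simp: f_def cos_b split: split_indicator)
  also have "\<dots> = ennreal (LBINT t:{0<..}. f t)"
    using int nonneg unfolding ei set_integrable_def set_lebesgue_integral_def
    by (intro nn_integral_eq_integral) auto
  also have "(LBINT t:{0<..}. f t) = pi / 2 * \<bar>a\<bar>"
    using eq by (simp add: interval_lebesgue_integral_0_infty b_def)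
  finally show ?thesis .
qed simp

section \<open>Joint measurability of evaluation\<close>

text \<open>
  The Borel \<open>\<sigma>\<close>-algebra of a product of nonseparable spaces can be larger than the product of
  the Borel \<open>\<sigma>\<close>-algebras, so continuity of evaluation does not give this directly. For
  \<open>X\<close> with countable range evaluation is a countable case distinction between maps
  \<open>l \<mapsto> l d\<close>; the general case is a pointwise limit of such maps.
\<close>
lemma measurable_blinfun_apply_separable:
  fixes X :: "'w \<Rightarrow> 'a::real_normed_vector"
  assumes [measurable]: "X \<in> borel_measurable M"
    and D: "countable D" and X: "\<And>\<omega>. \<omega> \<in> space M \<Longrightarrow> X \<omega> \<in> closure D"
  shows "(\<lambda>(l :: 'a \<Rightarrow>\<^sub>L real, \<omega>). l (X \<omega>)) \<in> borel_measurable (borel \<Otimes>\<^sub>M M)"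
proof (cases "D = {}")
  case True
  with X have "space M = {}" by auto
  then show ?thesis by (auto simp: measurable_def space_pair_measure)
next
  case False
  define d where "d = from_nat_into D"
  have d: "range d = D" unfolding d_def using False D by (rule range_from_nat_into)
  \<comment> \<open>\<open>d (k n \<omega>)\<close> is the first point of the enumeration of \<open>D\<close> that is close to \<open>X \<omega>\<close>\<close>
  define k where "k n \<omega> = (LEAST i. dist (d i) (X \<omega>) < 1 / real (Suc n))" for n \<omega>
  have [measurable]: "(\<lambda>x. dist c x) \<in> borel_measurable borel" for c :: 'a
    by (intro borel_measurable_continuous_onI continuous_intros)
  have [measurable]: "k n \<in> measurable M (count_space UNIV)" for n
    unfolding k_def by measurable
  have k: "dist (d (k n \<omega>)) (X \<omega>) < 1 / real (Suc n)" if "\<omega> \<in> space M" for n \<omega>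
  proof -
    have "\<exists>y\<in>D. dist y (X \<omega>) < 1 / real (Suc n)"
      using X[OF that] by (auto simp: closure_approachable)
    then show ?thesis unfolding k_def d[symmetric] by (auto intro: LeastI)
  qed
  show ?thesis
  proof (rule borel_measurable_LIMSEQ_metric)
    show "(\<lambda>(l :: 'a \<Rightarrow>\<^sub>L real, \<omega>). l (d (k n \<omega>))) \<in> borel_measurable (borel \<Otimes>\<^sub>M M)" for n
    proof -
      have [measurable]: "(\<lambda>l :: 'a \<Rightarrow>\<^sub>L real. l x) \<in> borel_measurable borel" for x
        by (intro borel_measurable_continuous_onI continuous_intros)
      have "(\<lambda>p. (\<lambda>i p. blinfun_apply (fst p) (d i)) (k n (snd p)) p) \<in> borel_measurable ((borel :: ('a \<Rightarrow>\<^sub>L real) measure) \<Otimes>\<^sub>M M)"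
        by (rule measurable_compose_countable) measurable
      then show ?thesis by (simp add: case_prod_beta')
    qed
    fix p :: "('a \<Rightarrow>\<^sub>L real) \<times> 'w" assume "p \<in> space (borel \<Otimes>\<^sub>M M)"
    then have "snd p \<in> space M" by (auto simp: space_pair_measure)
    have "(\<lambda>n. dist (d (k n (snd p))) (X (snd p))) \<longlonglongrightarrow> 0"
    proof (rule tendsto_sandwich[of "\<lambda>_. 0" _ _ "\<lambda>n. 1 / real (Suc n)"])
      show "(\<lambda>n. 1 / real (Suc n)) \<longlonglongrightarrow> 0"
        using LIMSEQ_inverse_real_of_nat by (simp only: inverse_eq_divide)
    qed (use k[OF \<open>snd p \<in> space M\<close>] in \<open>auto intro!: always_eventually less_imp_le\<close>)
    then have "(\<lambda>n. d (k n (snd p))) \<longlonglongrightarrow> X (snd p)"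
      by (rule tendsto_dist_iff[THEN iffD2])
    then show "(\<lambda>n. (\<lambda>(l, \<omega>). blinfun_apply l (d (k n \<omega>))) p) \<longlonglongrightarrow> (\<lambda>(l, \<omega>). blinfun_apply l (X \<omega>)) p"
      by (auto simp: case_prod_beta' intro!: tendsto_intros)
  qed
qed

section \<open>Finite products of arbitrary measures\<close>

lemma PiE_nonempty_image:
  assumes "Pi\<^sub>E I A \<noteq> {}" "i \<in> I"
  shows "(\<lambda>x. x i) ` Pi\<^sub>E I A = A i"
proof (intro subset_antisym subsetI)
  fix y assume "y \<in> A i"
  moreover obtain x where "x \<in> Pi\<^sub>E I A" using assms by auto
  ultimately have "x(i := y) \<in> Pi\<^sub>E I A"
    using assms(2) by (auto simp: PiE_iff extensional_def)
  then have "(x(i := y)) i \<in> (\<lambda>x. x i) ` Pi\<^sub>E I A" by (rule imageI)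
  then show "y \<in> (\<lambda>x. x i) ` Pi\<^sub>E I A" by simp
qed (use assms in auto)

text \<open>
  The difference of two boxes is cut into cells according to the set \<open>T\<close> of coordinates that
  leave the second box; \<open>T = {}\<close> would be the intersection. A nonempty index set is required
  because the empty set is not a box otherwise.
\<close>
lemma semiring_of_sets_boxes:
  assumes I: "finite I" "I \<noteq> {}"
  shows "semiring_of_sets (Pi\<^sub>E I (\<lambda>i. space (M i))) {Pi\<^sub>E I A |A. \<forall>i\<in>I. A i \<in> sets (M i)}"
    (is "semiring_of_sets ?\<Omega> ?G")
proof
  show "?G \<subseteq> Pow ?\<Omega>"
    by (auto intro: PiE_mono[THEN subsetD] dest: sets.sets_into_space)
  have "{} = Pi\<^sub>E I (\<lambda>_. {})" using I(2) by auto
  then show "{} \<in> ?G" by (intro CollectI exI conjI) auto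
  fix a b assume "a \<in> ?G" "b \<in> ?G"
  then obtain A B where a: "a = Pi\<^sub>E I A" and A: "\<forall>i\<in>I. A i \<in> sets (M i)"
    and b: "b = Pi\<^sub>E I B" and B: "\<forall>i\<in>I. B i \<in> sets (M i)" by auto
  show "a \<inter> b \<in> ?G"
    using A B unfolding a b PiE_Int by (intro CollectI exI[of _ "\<lambda>i. A i \<inter> B i"]) simp
  define cell where "cell T = Pi\<^sub>E I (\<lambda>i. if i \<in> T then A i - B i else A i \<inter> B i)" for T
  define C where "C = cell ` (Pow I - {{}})"
  have cell_iff: "x \<in> cell T \<longleftrightarrow> x \<in> Pi\<^sub>E I A \<and> T = {i\<in>I. x i \<notin> B i}" if "T \<subseteq> I" for x T
  proof
    assume "x \<in> cell T"
    then have ext: "x \<in> extensional I" and *: "\<And>i. i \<in> I \<Longrightarrow> x i \<in> A i \<and> (i \<in> T \<longleftrightarrow> x i \<notin> B i)"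
      by (auto simp: cell_def PiE_iff split: if_splits)
    with that show "x \<in> Pi\<^sub>E I A \<and> T = {i\<in>I. x i \<notin> B i}" by (auto simp: PiE_iff)
  qed (auto simp: cell_def PiE_iff)
  have "C \<subseteq> ?G"
  proof
    fix c assume "c \<in> C"
    then obtain T where "c = cell T" by (auto simp: C_def)
    then show "c \<in> ?G"
      using A B unfolding cell_def
      by (intro CollectI exI[of _ "\<lambda>i. if i \<in> T then A i - B i else A i \<inter> B i"]) simp
  qed
  moreover have "finite C" using I by (simp add: C_def)
  moreover have "disjoint C"
  proof (rule disjointI)
    fix c c' assume "c \<in> C" "c' \<in> C" "c \<noteq> c'"
    then obtain T T' where T: "c = cell T" "T \<subseteq> I" "c' = cell T'" "T' \<subseteq> I"
      by (auto simp: C_def)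
    with \<open>c \<noteq> c'\<close> have "T \<noteq> T'" by auto
    then show "c \<inter> c' = {}" using cell_iff[of T] cell_iff[of T'] T by blast
  qed
  moreover have "a - b = \<Union>C"
  proof (intro set_eqI iffI)
    fix x assume x: "x \<in> a - b"
    then have "{i\<in>I. x i \<notin> B i} \<in> Pow I - {{}}" by (auto simp: a b PiE_iff)
    moreover have "x \<in> cell {i\<in>I. x i \<notin> B i}" using x by (subst cell_iff) (auto simp: a)
    ultimately show "x \<in> \<Union>C" unfolding C_def by blast
  next
    fix x assume "x \<in> \<Union>C"
    then obtain T where "T \<subseteq> I" "T \<noteq> {}" "x \<in> cell T" by (auto simp: C_def)
    then show "x \<in> a - b" using cell_iff[of T x] by (auto simp: a b PiE_iff)
  qed
  ultimately show "\<exists>C\<subseteq>?G. finite C \<and> disjoint C \<and> a - b = \<Union>C" by blast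
qed

text \<open>
  Countable additivity of the volume of boxes without any finiteness condition. The indicator
  functions of the boxes add up pointwise, and integrating this identity in one coordinate at a
  time, by monotone convergence, replaces indicators by measures.
\<close>
lemma prod_emeasure_disjoint_boxes:
  assumes I: "finite I"
    and E: "\<And>i. i \<in> I \<Longrightarrow> E i \<in> sets (M i)"
    and F: "\<And>n i. i \<in> I \<Longrightarrow> F n i \<in> sets (M i)"
    and disj: "disjoint_family (\<lambda>n. Pi\<^sub>E I (F n))"
    and un: "(\<Union>n::nat. Pi\<^sub>E I (F n)) = Pi\<^sub>E I E"
  shows "(\<Sum>n. \<Prod>i\<in>I. emeasure (M i) (F n i)) = (\<Prod>i\<in>I. emeasure (M i) (E i))"
proof -
  have ind: "(\<Prod>i\<in>J. indicator (A i) (x i)) = (indicator (Pi\<^sub>E J A) (restrict x J) :: ennreal)"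
    if "finite J" for J A and x :: "'a \<Rightarrow> 'b"
    using that by (auto simp: indicator_def PiE_iff)
  \<comment> \<open>\<open>K\<close> is the set of coordinates that are already integrated out\<close>
  have "(\<Sum>n. (\<Prod>i\<in>K. emeasure (M i) (F n i)) * (\<Prod>i\<in>I - K. indicator (F n i) (x i))) =
        (\<Prod>i\<in>K. emeasure (M i) (E i)) * (\<Prod>i\<in>I - K. indicator (E i) (x i))"
    if "K \<subseteq> I" for K x
    using finite_subset[OF that I] that
  proof (induction K arbitrary: x rule: finite_induct)
    case empty
    show ?case by (simp add: ind I suminf_indicator[OF disj] un)
  next
    case (insert k K)
    then have k: "k \<in> I" "k \<notin> K" "K \<subseteq> I" and fin: "finite (I - insert k K)" using I by auto
    have split: "I - K = insert k (I - insert k K)" using k by auto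
    have step: "(\<integral>\<^sup>+y. (\<Prod>i\<in>K. emeasure (M i) (A i)) *
        (\<Prod>i\<in>I - K. indicator (A i) ((x(k := y)) i)) \<partial>M k) =
      (\<Prod>i\<in>insert k K. emeasure (M i) (A i)) * (\<Prod>i\<in>I - insert k K. indicator (A i) (x i))"
      if A: "A k \<in> sets (M k)" for A
    proof -
      have "(\<Prod>i\<in>I - K. indicator (A i) ((x(k := y)) i) :: ennreal) =
          indicator (A k) y * (\<Prod>i\<in>I - insert k K. indicator (A i) (x i))" for y
        unfolding split using fin by (subst prod.insert) (auto intro!: prod.cong)
      then show ?thesis
        using A insert.hyps
        by (simp add: nn_integral_cmult nn_integral_multc mult_ac)
    qed
    have m: "(\<lambda>y. (\<Prod>i\<in>K. emeasure (M i) (A i)) *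
        (\<Prod>i\<in>I - K. indicator (A i) ((x(k := y)) i))) \<in> borel_measurable (M k)"
      if "A k \<in> sets (M k)" for A
    proof -
      have "(\<lambda>y. indicator (A i) ((x(k := y)) i) :: ennreal) \<in> borel_measurable (M k)" for i
        using that by (cases "i = k") auto
      then show ?thesis by measurable
    qed
    have "(\<Sum>n. (\<Prod>i\<in>insert k K. emeasure (M i) (F n i)) *
          (\<Prod>i\<in>I - insert k K. indicator (F n i) (x i))) =
        (\<integral>\<^sup>+y. (\<Sum>n. (\<Prod>i\<in>K. emeasure (M i) (F n i)) *
          (\<Prod>i\<in>I - K. indicator (F n i) ((x(k := y)) i))) \<partial>M k)"
      by (subst nn_integral_suminf[OF m]) (simp_all only: step F k)
    also have "\<dots> = (\<integral>\<^sup>+y. (\<Prod>i\<in>K. emeasure (M i) (E i)) *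
          (\<Prod>i\<in>I - K. indicator (E i) ((x(k := y)) i)) \<partial>M k)"
      by (simp only: insert.IH[OF k(3)])
    also have "\<dots> = (\<Prod>i\<in>insert k K. emeasure (M i) (E i)) *
        (\<Prod>i\<in>I - insert k K. indicator (E i) (x i))"
      by (rule step) (use E k in auto)
    finally show ?case .
  qed
  from this[OF subset_refl] show ?thesis by simp
qed

text \<open>
  The product measure is defined as some extension of the box volume if there is one, and as 0
  otherwise. Without \<open>\<sigma>\<close>-finiteness iterated integrals cannot serve as the extension, since
  their inner integrals may fail to be measurable; Caratheodory's theorem provides one instead.
  It need not be unique, but all extensions agree on boxes.
\<close>
lemma emeasure_PiM_box:
  assumes I: "finite I" and A: "\<And>i. i \<in> I \<Longrightarrow> A i \<in> sets (M i)"
  shows "emeasure (PiM I M) (Pi\<^sub>E I A) = (\<Prod>i\<in>I. emeasure (M i) (A i))"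
proof (cases "I = {}")
  case False
  let ?\<Omega> = "Pi\<^sub>E I (\<lambda>i. space (M i))"
  let ?G = "{Pi\<^sub>E I A |A. \<forall>i\<in>I. A i \<in> sets (M i)}"
  interpret G: semiring_of_sets ?\<Omega> ?G by (rule semiring_of_sets_boxes[OF I False])
  \<comment> \<open>the sides of a nonempty box are its projections; if the box is empty, both products vanish\<close>
  define vol where "vol W = (\<Prod>i\<in>I. emeasure (M i) ((\<lambda>x. x i) ` W))" for W
  have vol: "vol (Pi\<^sub>E I B) = (\<Prod>i\<in>I. emeasure (M i) (B i))" for B
  proof (cases "Pi\<^sub>E I B = {}")
    case True
    then obtain i where "i \<in> I" "B i = {}" by (auto simp: PiE_eq_empty_iff)
    then have "(\<Prod>i\<in>I. emeasure (M i) (B i)) = 0" using I by (intro prod_zero) (auto intro!: bexI[of _ i])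
    moreover have "vol {} = 0" using I False by (auto simp: vol_def)
    ultimately show ?thesis using True by simp
  qed (auto simp: vol_def PiE_nonempty_image intro!: prod.cong)
  have "positive ?G vol"
    using I False by (auto simp: positive_def vol_def)
  moreover have "countably_additive ?G vol"
  proof (rule countably_additiveI)
    fix W :: "nat \<Rightarrow> _" assume W: "range W \<subseteq> ?G" "disjoint_family W" "(\<Union>n. W n) \<in> ?G"
    then obtain E where E: "(\<Union>n. W n) = Pi\<^sub>E I E" "\<forall>i\<in>I. E i \<in> sets (M i)" by auto
    have "\<exists>F. W n = Pi\<^sub>E I F \<and> (\<forall>i\<in>I. F i \<in> sets (M i))" for n
      using subsetD[OF W(1) rangeI[of W n]] by simp
    then obtain F where "\<And>n. W n = Pi\<^sub>E I (F n) \<and> (\<forall>i\<in>I. F n i \<in> sets (M i))"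
      using choice[of "\<lambda>n F. W n = Pi\<^sub>E I F \<and> (\<forall>i\<in>I. F i \<in> sets (M i))"] by auto
    then have F: "\<And>n. W n = Pi\<^sub>E I (F n)" "\<And>n i. i \<in> I \<Longrightarrow> F n i \<in> sets (M i)" by auto
    have W_eq: "W = (\<lambda>n. Pi\<^sub>E I (F n))" by (rule ext) (rule F(1))
    show "(\<Sum>n. vol (W n)) = vol (\<Union>n. W n)"
      using W(2) E unfolding W_eq vol
      by (simp add: vol prod_emeasure_disjoint_boxes[OF I _ F(2)])
  qed
  ultimately obtain \<nu> where \<nu>: "\<And>W. W \<in> ?G \<Longrightarrow> \<nu> W = vol W"
    and ms: "measure_space ?\<Omega> (sigma_sets ?\<Omega> ?G) \<nu>"
    using G.caratheodory by blast
  have sets_eq: "sets (PiM I M) = sigma_sets ?\<Omega> ?G"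
    unfolding sets_PiM prod_algebra_eq_finite[OF I] by (rule arg_cong2[where f=sigma_sets]) auto
  have "emeasure (PiM I M) (prod_emb I M I (Pi\<^sub>E I A)) = (\<Prod>i\<in>I. emeasure (M i) (A i))"
  proof (subst emeasure_extend_measure_Pair[OF PiM_def])
    show "positive (sets (PiM I M)) \<nu>" "countably_additive (sets (PiM I M)) \<nu>"
      using ms unfolding sets_eq measure_space_def by auto
    show "(I \<noteq> {} \<or> I = {}) \<and> finite I \<and> I \<subseteq> I \<and> A \<in> (\<Pi> j\<in>I. sets (M j))"
      using I A by auto
  next
    fix J E assume "(J \<noteq> {} \<or> I = {}) \<and> finite J \<and> J \<subseteq> I \<and> E \<in> (\<Pi> j\<in>J. sets (M j))"
    then have J: "J \<subseteq> I" "\<And>j. j \<in> J \<Longrightarrow> E j \<in> sets (M j)" by auto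
    then have emb: "prod_emb I M J (Pi\<^sub>E J E) = Pi\<^sub>E I (\<lambda>i. if i \<in> J then E i else space (M i))"
      by (intro prod_emb_PiE sets.sets_into_space) auto
    show "prod_emb I M J (Pi\<^sub>E J E) \<in> Pow ?\<Omega>"
      by (auto simp: prod_emb_def)
    have "\<nu> (prod_emb I M J (Pi\<^sub>E J E)) = vol (prod_emb I M J (Pi\<^sub>E J E))"
      unfolding emb using J
      by (intro \<nu> CollectI exI[of _ "\<lambda>i. if i \<in> J then E i else space (M i)"]) simp
    also have "\<dots> = (\<Prod>i\<in>I. if i \<in> J then emeasure (M i) (E i) else emeasure (M i) (space (M i)))"
      unfolding emb vol by (intro prod.cong) auto
    also have "\<dots> = (\<Prod>i\<in>J \<union> {i\<in>I. emeasure (M i) (space (M i)) \<noteq> 1}.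
        if i \<in> J then emeasure (M i) (E i) else emeasure (M i) (space (M i)))"
      using I J by (intro prod.mono_neutral_right) auto
    finally show "\<nu> (prod_emb I M J (Pi\<^sub>E J E)) = \<dots>" .
  qed (use I in \<open>auto intro!: prod.cong simp: Un_absorb2\<close>)
  then show ?thesis
    using A[THEN sets.sets_into_space] by simp
qed simp

section \<open>Tonelli's theorem on a \<open>\<sigma>\<close>-finite support\<close>

text \<open>
  By Markov's inequality every set where \<open>h n\<close> is at least \<open>1/m\<close> has finite measure, and the
  complement of the support is a null set of the restricted measure.
\<close>
lemma sigma_finite_density_support:
  fixes h :: "nat \<Rightarrow> 'b \<Rightarrow> ennreal"
  assumes [measurable]: "\<And>n. h n \<in> borel_measurable N"
    and fin: "\<And>n. (\<integral>\<^sup>+z. h n z \<partial>N) \<noteq> \<infinity>"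
  shows "sigma_finite_measure (density N (indicator {z\<in>space N. \<exists>n. h n z \<noteq> 0}))"
    (is "sigma_finite_measure (density N (indicator ?S))")
proof
  define A where "A = (\<lambda>(n, m). {z\<in>space N. 1 \<le> of_nat (Suc m) * h n z})"
  have [measurable]: "A p \<in> sets N" for p
    by (cases p) (simp add: A_def)
  have [measurable]: "?S \<in> sets N" by measurable
  have finA: "emeasure N (A p) \<noteq> \<infinity>" for p
  proof -
    obtain n m where p: "p = (n, m)" by (cases p)
    have "emeasure N (A p) \<le> of_nat (Suc m) * (\<integral>\<^sup>+z. h n z * indicator (space N) z \<partial>N)"
      using nn_integral_Markov_inequality[of "h n" "space N" N "of_nat (Suc m)"]
      unfolding p A_def by (auto simp: mult.commute cong: conj_cong)
    also have "\<dots> = of_nat (Suc m) * (\<integral>\<^sup>+z. h n z \<partial>N)"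
      by (intro arg_cong2[where f="(*)"] nn_integral_cong) auto
    also have "\<dots> < \<infinity>"
      using fin[of n] by (auto simp: ennreal_mult_less_top less_top of_nat_less_top)
    finally show ?thesis by simp
  qed
  have "\<exists>p. z \<in> A p" if z: "z \<in> ?S" for z
  proof -
    obtain n where n: "h n z \<noteq> 0" using z by auto
    have "\<exists>m. 1 \<le> of_nat (Suc m) * h n z"
    proof (cases "h n z")
      case (real r)
      then have r: "r > 0" using n by (cases "r = 0") auto
      obtain m where "inverse r < real m" using reals_Archimedean2 by blast
      then have "1 \<le> real (Suc m) * r" using r by (simp add: field_simps)
      then have "1 \<le> ennreal (real (Suc m)) * ennreal r"
        by (metis ennreal_leI ennreal_1 ennreal_mult' of_nat_0_le_iff)
      then show ?thesis unfolding real ennreal_of_nat_eq_real_of_nat by blast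
    qed (auto simp: ennreal_mult_top intro!: exI[of _ 0])
    then obtain m where "1 \<le> of_nat (Suc m) * h n z" ..
    then have "z \<in> A (n, m)" using z by (auto simp: A_def)
    then show ?thesis ..
  qed
  then have cover: "?S \<subseteq> (\<Union>p. A p)" by blast
  have fin_restr: "emeasure (density N (indicator ?S)) (A p) \<noteq> \<infinity>" for p
  proof -
    have "emeasure (density N (indicator ?S)) (A p) = emeasure N (?S \<inter> A p)"
      by (simp add: emeasure_restricted)
    also have "\<dots> \<le> emeasure N (A p)" by (intro emeasure_mono) auto
    finally show ?thesis using finA[of p] by (auto simp: top_unique)
  qed
  have null: "emeasure (density N (indicator ?S)) (space N - ?S) = 0"
    by (subst emeasure_restricted) auto
  let ?F = "insert (space N - ?S) (range A)"
  have "\<Union>?F = space N" using cover by (auto simp: A_def)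
  moreover have "?F \<subseteq> sets N" by auto
  moreover have "\<forall>a\<in>?F. emeasure (density N (indicator ?S)) a \<noteq> \<infinity>"
    using fin_restr null by (auto simp: infinity_ennreal_def)
  ultimately show "\<exists>F. countable F \<and> F \<subseteq> sets (density N (indicator ?S)) \<and>
      \<Union>F = space (density N (indicator ?S)) \<and> (\<forall>a\<in>F. emeasure (density N (indicator ?S)) a \<noteq> \<infinity>)"
    by (intro exI[of _ ?F] conjI) simp_all
qed

text \<open>
  Restricting the product measure to a box with \<open>\<sigma>\<close>-finite sides gives a measure with the box
  volumes of the product of the restrictions, and for \<open>\<sigma>\<close>-finite measures these volumes
  determine it. The choice of extension in the product measure is thus invisible to
  integrands supported on such a box.
\<close>
lemma nn_integral_PiM_support:
  assumes I: "finite I" and S[measurable]: "S \<in> sets N"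
    and sf: "sigma_finite_measure (density N (indicator S))"
    and f[measurable]: "f \<in> borel_measurable (PiM I (\<lambda>_. N))"
    and off: "\<And>z i. z \<in> space (PiM I (\<lambda>_. N)) \<Longrightarrow> i \<in> I \<Longrightarrow> z i \<notin> S \<Longrightarrow> f z = 0"
  shows "(\<integral>\<^sup>+z. f z \<partial>PiM I (\<lambda>_. N)) = (\<integral>\<^sup>+z. f z \<partial>PiM I (\<lambda>_. density N (indicator S)))"
proof -
  let ?P = "PiM I (\<lambda>_. N)" and ?N = "density N (indicator S)"
  interpret N: sigma_finite_measure ?N by fact
  interpret product_sigma_finite "\<lambda>_ :: 'a. ?N" ..
  have [measurable]: "Pi\<^sub>E I (\<lambda>_. S) \<in> sets ?P" using I by measurable
  have "density ?P (indicator (Pi\<^sub>E I (\<lambda>_. S))) = PiM I (\<lambda>_. ?N)"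
  proof (rule PiM_eqI[OF I])
    show "sets (density ?P (indicator (Pi\<^sub>E I (\<lambda>_. S)))) = sets (PiM I (\<lambda>_. ?N))"
      by (simp cong: sets_PiM_cong)
  next
    fix A assume "\<And>i. i \<in> I \<Longrightarrow> A i \<in> sets ?N"
    then have A[measurable]: "\<And>i. i \<in> I \<Longrightarrow> A i \<in> sets N" by simp
    have [measurable]: "Pi\<^sub>E I A \<in> sets ?P" using I A by (intro sets_PiM_I_finite)
    have "emeasure (density ?P (indicator (Pi\<^sub>E I (\<lambda>_. S)))) (Pi\<^sub>E I A) =
        emeasure ?P (Pi\<^sub>E I (\<lambda>_. S) \<inter> Pi\<^sub>E I A)"
      by (simp add: emeasure_restricted)
    also have "\<dots> = emeasure ?P (Pi\<^sub>E I (\<lambda>i. S \<inter> A i))" by (simp add: PiE_Int)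
    also have "\<dots> = (\<Prod>i\<in>I. emeasure N (S \<inter> A i))"
      using I A by (intro emeasure_PiM_box) auto
    also have "\<dots> = (\<Prod>i\<in>I. emeasure ?N (A i))"
      using A by (intro prod.cong) (auto simp: emeasure_restricted)
    finally show "emeasure (density ?P (indicator (Pi\<^sub>E I (\<lambda>_. S)))) (Pi\<^sub>E I A) =
        (\<Prod>i\<in>I. emeasure ?N (A i))" .
  qed
  then have "(\<integral>\<^sup>+z. f z \<partial>PiM I (\<lambda>_. ?N)) = (\<integral>\<^sup>+z. f z \<partial>density ?P (indicator (Pi\<^sub>E I (\<lambda>_. S))))"
    by simp
  also have "\<dots> = (\<integral>\<^sup>+z. indicator (Pi\<^sub>E I (\<lambda>_. S)) z * f z \<partial>?P)"
    by (rule nn_integral_density) measurable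
  also have "\<dots> = (\<integral>\<^sup>+z. f z \<partial>?P)"
    using off by (intro nn_integral_cong) (auto simp: space_PiM PiE_iff split: split_indicator)
  finally show ?thesis by simp
qed

text \<open>
  The inner integral over the product space factors, which gives the power on the right.
\<close>
lemma nn_integral_prod_PiM_swap:
  assumes I: "finite I" and M: "sigma_finite_measure M" and S[measurable]: "S \<in> sets N"
    and sf: "sigma_finite_measure (density N (indicator S))"
    and h[measurable]: "(\<lambda>(z, \<omega>). h z \<omega>) \<in> borel_measurable (N \<Otimes>\<^sub>M M)"
    and off: "\<And>z \<omega>. z \<in> space N \<Longrightarrow> \<omega> \<in> space M \<Longrightarrow> z \<notin> S \<Longrightarrow> h z \<omega> = 0"
  shows "(\<integral>\<^sup>+z. (\<integral>\<^sup>+\<omega>. (\<Prod>i\<in>I. h (z i) \<omega>) \<partial>M) \<partial>PiM I (\<lambda>_. N)) =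
    (\<integral>\<^sup>+\<omega>. (\<integral>\<^sup>+z. h z \<omega> \<partial>N) ^ card I \<partial>M)"
proof -
  let ?N = "density N (indicator S)"
  interpret M: sigma_finite_measure M by fact
  interpret N: sigma_finite_measure ?N by fact
  interpret product_sigma_finite "\<lambda>_ :: 'a. ?N" ..
  interpret P: sigma_finite_measure "PiM I (\<lambda>_. ?N)" using I by (rule sigma_finite)
  interpret PM: pair_sigma_finite "PiM I (\<lambda>_. ?N)" M ..
  have prod_meas[measurable]: "(\<lambda>(z, \<omega>). \<Prod>i\<in>I. h (z i) \<omega>) \<in> borel_measurable (PiM I (\<lambda>_. N) \<Otimes>\<^sub>M M)"
    unfolding case_prod_beta'
  proof (rule borel_measurable_prod_ennreal)
    fix i assume [measurable]: "i \<in> I"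
    have "(\<lambda>x. (fst x i, snd x)) \<in> (PiM I (\<lambda>_. N) \<Otimes>\<^sub>M M) \<rightarrow>\<^sub>M N \<Otimes>\<^sub>M M"
      by measurable
    from measurable_compose[OF this h]
    show "(\<lambda>x. h (fst x i) (snd x)) \<in> borel_measurable (PiM I (\<lambda>_. N) \<Otimes>\<^sub>M M)" by simp
  qed
  have prod_meas': "(\<lambda>(z, \<omega>). \<Prod>i\<in>I. h (z i) \<omega>) \<in> borel_measurable (PiM I (\<lambda>_. ?N) \<Otimes>\<^sub>M M)"
    using prod_meas by (simp cong: measurable_cong_sets sets_PiM_cong sets_pair_measure_cong)
  have "(\<integral>\<^sup>+z. (\<integral>\<^sup>+\<omega>. (\<Prod>i\<in>I. h (z i) \<omega>) \<partial>M) \<partial>PiM I (\<lambda>_. N)) =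
      (\<integral>\<^sup>+z. (\<integral>\<^sup>+\<omega>. (\<Prod>i\<in>I. h (z i) \<omega>) \<partial>M) \<partial>PiM I (\<lambda>_. ?N))"
  proof (rule nn_integral_PiM_support[OF I S sf])
    show "(\<lambda>z. \<integral>\<^sup>+\<omega>. (\<Prod>i\<in>I. h (z i) \<omega>) \<partial>M) \<in> borel_measurable (PiM I (\<lambda>_. N))"
      by (rule M.borel_measurable_nn_integral) (rule prod_meas)
    fix z i assume z: "z \<in> space (PiM I (\<lambda>_. N))" "i \<in> I" "z i \<notin> S"
    then have "z i \<in> space N" by (auto simp: space_PiM)
    then have "(\<Prod>i\<in>I. h (z i) \<omega>) = 0" if "\<omega> \<in> space M" for \<omega>
      using z I off[of "z i" \<omega>] that by (intro prod_zero) auto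
    then show "(\<integral>\<^sup>+\<omega>. (\<Prod>i\<in>I. h (z i) \<omega>) \<partial>M) = 0"
      by (subst nn_integral_cong[where v = "\<lambda>_. 0"]) auto
  qed
  also have "\<dots> = (\<integral>\<^sup>+\<omega>. (\<integral>\<^sup>+z. (\<Prod>i\<in>I. h (z i) \<omega>) \<partial>PiM I (\<lambda>_. ?N)) \<partial>M)"
    by (rule PM.Fubini'[OF prod_meas', symmetric])
  also have "\<dots> = (\<integral>\<^sup>+\<omega>. (\<integral>\<^sup>+z. h z \<omega> \<partial>N) ^ card I \<partial>M)"
  proof (rule nn_integral_cong)
    fix \<omega> assume \<omega>: "\<omega> \<in> space M"
    have [measurable]: "(\<lambda>z. h z \<omega>) \<in> borel_measurable N"
      using measurable_compose[OF measurable_Pair2'[OF \<omega>] h] by simp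
    have "(\<integral>\<^sup>+z. h z \<omega> \<partial>?N) = (\<integral>\<^sup>+z. indicator S z * h z \<omega> \<partial>N)"
      by (intro nn_integral_density) auto
    also have "\<dots> = (\<integral>\<^sup>+z. h z \<omega> \<partial>N)"
      using off[OF _ \<omega>] by (intro nn_integral_cong) (auto split: split_indicator)
    finally show "(\<integral>\<^sup>+z. (\<Prod>i\<in>I. h (z i) \<omega>) \<partial>PiM I (\<lambda>_. ?N)) = (\<integral>\<^sup>+z. h z \<omega> \<partial>N) ^ card I"
      by (subst product_nn_integral_prod[OF I]) auto
  qed
  finally show ?thesis .
qed

section \<open>Expansion into characteristic functions\<close>

lemma prod_trinomial_expand:
  fixes u v :: "'b \<Rightarrow> 'c::comm_semiring_1"
  assumes "finite I"
  shows "(\<Prod>i\<in>I. 1 + u i + v i) =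
    (\<Sum>(A, B)\<in>{(A, B). A \<subseteq> I \<and> B \<subseteq> I \<and> A \<inter> B = {}}. prod u A * prod v B)"
proof -
  have "(\<Prod>i\<in>I. 1 + u i + v i) = (\<Prod>i\<in>I. u i + (v i + 1))"
    by (simp add: ac_simps)
  also have "\<dots> = (\<Sum>A\<in>Pow I. prod u A * (\<Sum>B\<in>Pow (I - A). prod v B))"
    using assms by (simp add: prod_add)
  also have "\<dots> = (\<Sum>(A, B)\<in>Sigma (Pow I) (\<lambda>A. Pow (I - A)). prod u A * prod v B)"
    using assms by (subst sum.Sigma[symmetric]) (auto simp: sum_distrib_left)
  also have "Sigma (Pow I) (\<lambda>A. Pow (I - A)) = {(A, B). A \<subseteq> I \<and> B \<subseteq> I \<and> A \<inter> B = {}}"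
    by auto
  finally show ?thesis .
qed

lemma one_minus_cf_expectation_cos:
  "one_minus_cf_expectation M X j l t =
    (\<integral>\<omega>. (\<Prod>\<alpha>\<in>{1..j}. 1 - cos (t \<alpha> * blinfun_apply (l \<alpha>) (X \<omega>))) \<partial>M)"
  by (simp add: one_minus_cf_expectation_def Re_exp)

lemma one_minus_cf_expectation_expand:
  fixes X :: "'w \<Rightarrow> 'a::real_normed_vector"
  assumes M: "prob_space M" and [measurable]: "X \<in> borel_measurable M"
  shows "complex_of_real (one_minus_cf_expectation M X j l t) =
    (\<Sum>(A, B)\<in>disjoint_pairs j. (- 1 / 2) ^ card (A \<union> B) *
      (\<integral>\<omega>. exp (\<i> * complex_of_real (blinfun_apply
          ((\<Sum>\<alpha>\<in>A. t \<alpha> *\<^sub>R l \<alpha>) - (\<Sum>\<beta>\<in>B. t \<beta> *\<^sub>R l \<beta>)) (X \<omega>))) \<partial>M))"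
proof -
  interpret prob_space M by fact
  define \<theta> where "\<theta> \<alpha> \<omega> = t \<alpha> * blinfun_apply (l \<alpha>) (X \<omega>)" for \<alpha> \<omega>
  define e where "e A B \<omega> = exp (\<i> * complex_of_real (blinfun_apply
      ((\<Sum>\<alpha>\<in>A. t \<alpha> *\<^sub>R l \<alpha>) - (\<Sum>\<beta>\<in>B. t \<beta> *\<^sub>R l \<beta>)) (X \<omega>)))" for A B \<omega>
  have cos_exp: "complex_of_real (1 - cos x) = 1 + - 1 / 2 * exp (\<i> * x) + - 1 / 2 * exp (- (\<i> * x))"
    for x :: real
    by (simp add: cos_of_real[symmetric] cos_exp_eq field_simps)
  have prod_e: "(\<Prod>\<alpha>\<in>A. - 1 / 2 * exp (\<i> * \<theta> \<alpha> \<omega>)) * (\<Prod>\<beta>\<in>B. - 1 / 2 * exp (- (\<i> * \<theta> \<beta> \<omega>))) =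
      (- 1 / 2) ^ card (A \<union> B) * e A B \<omega>"
    if "(A, B) \<in> disjoint_pairs j" for A B \<omega>
  proof -
    have AB: "finite A" "finite B" "A \<inter> B = {}"
      using that finite_subset[of _ "{1..j}"] by (auto simp: disjoint_pairs_def)
    have "e A B \<omega> = exp ((\<Sum>\<alpha>\<in>A. \<i> * \<theta> \<alpha> \<omega>) + (\<Sum>\<beta>\<in>B. - (\<i> * \<theta> \<beta> \<omega>)))"
      by (simp add: e_def \<theta>_def blinfun.diff_left blinfun.sum_left blinfun.scaleR_left
          sum_distrib_left sum_negf algebra_simps)
    also have "\<dots> = (\<Prod>\<alpha>\<in>A. exp (\<i> * \<theta> \<alpha> \<omega>)) * (\<Prod>\<beta>\<in>B. exp (- (\<i> * \<theta> \<beta> \<omega>)))"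
      using AB by (simp add: exp_add exp_sum)
    finally show ?thesis
      using AB unfolding prod.distrib prod_constant
      by (simp add: card_Un_disjoint power_add)
  qed
  have [measurable]: "(\<lambda>x. blinfun_apply f x) \<in> borel_measurable borel" for f :: "'a \<Rightarrow>\<^sub>L real"
    by (intro borel_measurable_continuous_onI continuous_intros)
  have int_e: "integrable M (e A B)" for A B
    unfolding e_def by (rule integrable_const_bound[where B = 1]) auto
  have "complex_of_real (one_minus_cf_expectation M X j l t) =
      (\<integral>\<omega>. (\<Prod>\<alpha>\<in>{1..j}. complex_of_real (1 - cos (\<theta> \<alpha> \<omega>))) \<partial>M)"
    unfolding one_minus_cf_expectation_cos \<theta>_def
    by (subst integral_complex_of_real[symmetric]) (simp only: of_real_prod)
  also have "\<dots> = (\<integral>\<omega>. (\<Sum>(A, B)\<in>disjoint_pairs j. (- 1 / 2) ^ card (A \<union> B) * e A B \<omega>) \<partial>M)"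
    unfolding cos_exp prod_trinomial_expand[OF finite_atLeastAtMost] disjoint_pairs_def[symmetric]
    by (intro Bochner_Integration.integral_cong refl sum.cong) (auto simp only: prod_e)
  also have "\<dots> = (\<Sum>(A, B)\<in>disjoint_pairs j. (- 1 / 2) ^ card (A \<union> B) * (\<integral>\<omega>. e A B \<omega> \<partial>M))"
    unfolding case_prod_beta' by (simp add: int_e)
  finally show ?thesis unfolding e_def .
qed

section \<open>Moments of the norm\<close>

text \<open>
  The argument is carried out for a modification \<open>Y\<close> of \<open>X\<close> with all values in the closure of
  \<open>D\<close>, which is needed both for joint measurability and for the support \<open>S\<close> to be the same for
  all \<open>\<omega>\<close>.
\<close>
lemma nn_integral_norm_power:
  fixes \<mu> :: "('a::real_normed_vector \<Rightarrow>\<^sub>L real) measure"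
  assumes borel_mu: "sets \<mu> = sets borel"
    and norm_repr: "\<And>x::'a. ennreal (norm x) = (\<integral>\<^sup>+l. ennreal \<bar>blinfun_apply l x\<bar> \<partial>\<mu>)"
    and X: "random_vector M X"
  shows "(\<integral>\<^sup>+\<omega>. ennreal (norm (X \<omega>) ^ j) \<partial>M) =
      ennreal ((2 / pi) ^ j) *
      (\<integral>\<^sup>+z. ennreal (one_minus_cf_expectation M X j (\<lambda>\<alpha>. fst (z \<alpha>)) (\<lambda>\<alpha>. snd (z \<alpha>))
              * (\<Prod>\<alpha>\<in>{1..j}. 1 / (snd (z \<alpha>))\<^sup>2))
        \<partial>(PiM {1..j} (\<lambda>\<alpha>. \<mu> \<Otimes>\<^sub>M restrict_space lborel {0<..})))"
proof -
  from X obtain D0 where "prob_space M" and X_meas[measurable]: "X \<in> borel_measurable M"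
    and D0: "countable D0" "AE \<omega> in M. X \<omega> \<in> closure D0"
    by (auto simp: random_vector_def)
  interpret prob_space M by fact
  \<comment> \<open>the point 0 is added as the default value of the modification\<close>
  define D where "D = insert 0 D0"
  have D: "countable D" using D0 by (simp add: D_def)
  define Y where "Y \<omega> = (if X \<omega> \<in> closure D then X \<omega> else 0)" for \<omega>
  have [measurable]: "closure D \<in> sets borel" by (rule borel_closed) simp
  have [measurable]: "Y \<in> borel_measurable M" unfolding Y_def by measurable
  have Y_closure: "Y \<omega> \<in> closure D" for \<omega>
    using closure_subset[of D] by (auto simp: Y_def D_def)
  have Y_AE: "AE \<omega> in M. X \<omega> = Y \<omega>"
    using D0(2) by eventually_elim (use closure_mono[of D0 D] in \<open>auto simp: Y_def D_def\<close>)
  define L where "L = (restrict_space lborel {0<..} :: real measure)"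
  interpret L: sigma_finite_measure L
    unfolding L_def by (rule sigma_finite_measure_restrict_space[OF sigma_finite_lborel]) auto
  have id_L[measurable]: "(\<lambda>t. t) \<in> borel_measurable L"
    unfolding L_def by (rule measurable_restrict_space1) simp
  define N where "N = \<mu> \<Otimes>\<^sub>M L"
  have meas_mu: "f \<in> borel_measurable \<mu> \<longleftrightarrow> f \<in> borel_measurable borel" for f :: "_ \<Rightarrow> real"
    by (rule arg_cong2[where f="(\<in>)"] refl measurable_cong_sets borel_mu)+
  have [measurable]: "(\<lambda>l. blinfun_apply l x) \<in> borel_measurable \<mu>" for x
    unfolding meas_mu by (intro borel_measurable_continuous_onI continuous_intros)

  define g where "g x z = ennreal ((1 - cos (snd z * blinfun_apply (fst z) x)) / (snd z)\<^sup>2)"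
    for x :: 'a and z
  have g_meas[measurable]: "g x \<in> borel_measurable N" for x
    unfolding g_def N_def by measurable
  have g_int: "(\<integral>\<^sup>+z. g x z \<partial>N) = ennreal (pi / 2) * ennreal (norm x)" for x
  proof -
    have "(\<integral>\<^sup>+z. g x z \<partial>N) = (\<integral>\<^sup>+l. (\<integral>\<^sup>+t. g x (l, t) \<partial>L) \<partial>\<mu>)"
      unfolding N_def using g_meas[of x] by (intro L.nn_integral_fst[symmetric]) (simp add: N_def)
    also have "\<dots> = (\<integral>\<^sup>+l. ennreal (pi / 2) * ennreal \<bar>blinfun_apply l x\<bar> \<partial>\<mu>)"
      unfolding g_def L_def by (simp add: nn_integral_one_minus_cos ennreal_mult[symmetric])
    also have "\<dots> = ennreal (pi / 2) * ennreal (norm x)"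
      by (subst nn_integral_cmult) (auto simp: norm_repr)
    finally show ?thesis .
  qed

  define S where "S = {z\<in>space N. \<exists>n. g (from_nat_into D n) z \<noteq> 0}"
  have S_meas: "S \<in> sets N" unfolding S_def by measurable
  have S_fin: "sigma_finite_measure (density N (indicator S))"
    unfolding S_def by (rule sigma_finite_density_support) (auto simp: g_int ennreal_mult_eq_top_iff)
  have off: "g (Y \<omega>) z = 0" if "z \<in> space N" "z \<notin> S" for z \<omega>
  proof -
    have zero: "g x z = 0" if x: "x \<in> D" for x
      using from_nat_into_surj[OF D x] \<open>z \<in> space N\<close> \<open>z \<notin> S\<close> by (auto simp: S_def)
    \<comment> \<open>\<open>x \<mapsto> g x z\<close> is continuous, so it vanishes on the closure of \<open>D\<close> once it vanishes on \<open>D\<close>\<close>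
    have "closed {x. g x z = 0}"
      unfolding g_def divide_inverse
      by (intro closed_Collect_eq continuous_on_ennreal continuous_intros)
    with zero have "closure D \<subseteq> {x. g x z = 0}" by (intro closure_minimal) auto
    then show ?thesis using Y_closure by auto
  qed
  have pair_meas: "(\<lambda>(z, \<omega>). g (Y \<omega>) z) \<in> borel_measurable (N \<Otimes>\<^sub>M M)"
  proof -
    have "(\<lambda>(l :: 'a \<Rightarrow>\<^sub>L real, \<omega>). blinfun_apply l (Y \<omega>)) \<in> borel_measurable (borel \<Otimes>\<^sub>M M)"
      by (rule measurable_blinfun_apply_separable[OF _ D]) (auto simp: Y_closure)
    then have *: "(\<lambda>(l, \<omega>). blinfun_apply l (Y \<omega>)) \<in> borel_measurable (\<mu> \<Otimes>\<^sub>M M)"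
      by (simp add: borel_mu cong: measurable_cong_sets sets_pair_measure_cong)
    have [measurable]: "(\<lambda>p. blinfun_apply (fst (fst p)) (Y (snd p))) \<in> borel_measurable (N \<Otimes>\<^sub>M M)"
      using measurable_compose[OF _ *, of "\<lambda>p. (fst (fst p), snd p)" "N \<Otimes>\<^sub>M M"]
      by (simp add: N_def)
    have [measurable]: "(\<lambda>p. snd (fst p)) \<in> borel_measurable (N \<Otimes>\<^sub>M M)"
      unfolding N_def by measurable
    show ?thesis unfolding g_def case_prod_beta' by measurable
  qed

  have integrand: "ennreal (one_minus_cf_expectation M X j (\<lambda>\<alpha>. fst (z \<alpha>)) (\<lambda>\<alpha>. snd (z \<alpha>))
      * (\<Prod>\<alpha>\<in>{1..j}. 1 / (snd (z \<alpha>))\<^sup>2)) = (\<integral>\<^sup>+\<omega>. (\<Prod>\<alpha>\<in>{1..j}. g (Y \<omega>) (z \<alpha>)) \<partial>M)" for z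
  proof -
    have [measurable]: "(\<lambda>x. blinfun_apply f x) \<in> borel_measurable borel" for f :: "'a \<Rightarrow>\<^sub>L real"
      by (intro borel_measurable_continuous_onI continuous_intros)
    define p where "p \<omega> = (\<Prod>\<alpha>\<in>{1..j}. 1 - cos (snd (z \<alpha>) * blinfun_apply (fst (z \<alpha>)) (X \<omega>)))" for \<omega>
    have p_nonneg: "0 \<le> p \<omega>" for \<omega> unfolding p_def by (intro prod_nonneg) auto
    have p_le: "p \<omega> \<le> 2 ^ j" for \<omega>
    proof -
      have "p \<omega> \<le> (\<Prod>\<alpha>\<in>{1..j}. 2)" unfolding p_def
      proof (intro prod_mono conjI)
        fix \<alpha> show "1 - cos (snd (z \<alpha>) * blinfun_apply (fst (z \<alpha>)) (X \<omega>)) \<le> 2"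
          using cos_ge_minus_one[of "snd (z \<alpha>) * blinfun_apply (fst (z \<alpha>)) (X \<omega>)"] by linarith
      qed auto
      then show ?thesis by simp
    qed
    have p_int: "integrable M p"
    proof (rule integrable_const_bound[where B = "2 ^ j"])
      show "p \<in> borel_measurable M" unfolding p_def by measurable
    qed (use p_nonneg p_le in auto)
    let ?c = "\<Prod>\<alpha>\<in>{1..j}. 1 / (snd (z \<alpha>))\<^sup>2"
    have "one_minus_cf_expectation M X j (\<lambda>\<alpha>. fst (z \<alpha>)) (\<lambda>\<alpha>. snd (z \<alpha>)) * ?c = (\<integral>\<omega>. p \<omega> * ?c \<partial>M)"
      by (simp add: one_minus_cf_expectation_cos p_def)
    also have "ennreal \<dots> = (\<integral>\<^sup>+\<omega>. ennreal (p \<omega> * ?c) \<partial>M)"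
      using p_int p_nonneg
      by (intro nn_integral_eq_integral[symmetric]) (auto intro!: mult_nonneg_nonneg prod_nonneg)
    also have "\<dots> = (\<integral>\<^sup>+\<omega>. (\<Prod>\<alpha>\<in>{1..j}. g (Y \<omega>) (z \<alpha>)) \<partial>M)"
    proof (rule nn_integral_cong_AE)
      show "AE \<omega> in M. ennreal (p \<omega> * ?c) = (\<Prod>\<alpha>\<in>{1..j}. g (Y \<omega>) (z \<alpha>))"
        using Y_AE
      proof eventually_elim
        case (elim \<omega>)
        show ?case
          unfolding p_def g_def prod.distrib[symmetric] elim
          by (subst prod_ennreal) auto
      qed
    qed
    finally show ?thesis .
  qed

  have "(\<integral>\<^sup>+z. (\<integral>\<^sup>+\<omega>. (\<Prod>\<alpha>\<in>{1..j}. g (Y \<omega>) (z \<alpha>)) \<partial>M) \<partial>PiM {1..j} (\<lambda>_. N)) =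
      (\<integral>\<^sup>+\<omega>. (\<integral>\<^sup>+z. g (Y \<omega>) z \<partial>N) ^ card {1..j} \<partial>M)"
    by (rule nn_integral_prod_PiM_swap[OF _ _ S_meas S_fin pair_meas])
       (auto simp: off sigma_finite_measure_axioms)
  also have "\<dots> = (\<integral>\<^sup>+\<omega>. ennreal ((pi / 2) ^ j) * ennreal (norm (X \<omega>) ^ j) \<partial>M)"
    using Y_AE by (intro nn_integral_cong_AE, eventually_elim)
      (simp add: g_int power_mult_distrib ennreal_power)
  also have "\<dots> = ennreal ((pi / 2) ^ j) * (\<integral>\<^sup>+\<omega>. ennreal (norm (X \<omega>) ^ j) \<partial>M)"
    by (rule nn_integral_cmult) measurable
  finally have swap: "(\<integral>\<^sup>+z. (\<integral>\<^sup>+\<omega>. (\<Prod>\<alpha>\<in>{1..j}. g (Y \<omega>) (z \<alpha>)) \<partial>M) \<partial>PiM {1..j} (\<lambda>_. N)) =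
      ennreal ((pi / 2) ^ j) * (\<integral>\<^sup>+\<omega>. ennreal (norm (X \<omega>) ^ j) \<partial>M)" .
  have "ennreal ((2 / pi) ^ j) * ennreal ((pi / 2) ^ j) = 1"
    by (simp add: ennreal_mult[symmetric] power_mult_distrib[symmetric])
  then show ?thesis
    unfolding integrand L_def[symmetric] N_def[symmetric] swap mult.assoc[symmetric] by simp
qed

theorem mainTheorem4:
  fixes \<mu> :: "('a::real_normed_vector \<Rightarrow>\<^sub>L real) measure"
    and M :: "'w measure"
    and X :: "'w \<Rightarrow> 'a"
    and j :: nat
  assumes borel_mu: "sets \<mu> = sets borel"
    and norm_repr: "\<And>x::'a. ennreal (norm x) = (\<integral>\<^sup>+l. ennreal \<bar>blinfun_apply l x\<bar> \<partial>\<mu>)"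
    and X: "random_vector M X"
  shows "(\<integral>\<^sup>+\<omega>. ennreal (norm (X \<omega>) ^ j) \<partial>M) =
      ennreal ((2 / pi) ^ j) *
      (\<integral>\<^sup>+z. ennreal (one_minus_cf_expectation M X j (\<lambda>\<alpha>. fst (z \<alpha>)) (\<lambda>\<alpha>. snd (z \<alpha>))
              * (\<Prod>\<alpha>\<in>{1..j}. 1 / (snd (z \<alpha>))\<^sup>2))
        \<partial>(PiM {1..j} (\<lambda>\<alpha>. \<mu> \<Otimes>\<^sub>M restrict_space lborel {0<..})))
    \<and> (\<forall>(l :: nat \<Rightarrow> 'a \<Rightarrow>\<^sub>L real) (t :: nat \<Rightarrow> real). (\<forall>\<alpha>\<in>{1..j}. 0 < t \<alpha>) \<longrightarrow>
        complex_of_real (one_minus_cf_expectation M X j l t) =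
        (\<Sum>(A, B)\<in>disjoint_pairs j. (- 1 / 2) ^ card (A \<union> B) *
          (\<integral>\<omega>. exp (\<i> * complex_of_real (blinfun_apply
              ((\<Sum>\<alpha>\<in>A. t \<alpha> *\<^sub>R l \<alpha>) - (\<Sum>\<beta>\<in>B. t \<beta> *\<^sub>R l \<beta>)) (X \<omega>))) \<partial>M)))"
  using nn_integral_norm_power[OF borel_mu norm_repr X] one_minus_cf_expectation_expand X
  unfolding random_vector_def by blast

end
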